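(* Assume that $a_{ij}>0$ for all $i\in N$, $j\in M$ (MAC). Then every Pareto optimal allocation can be obtained under one of the following alternative conditions; that is, for every Pareto optimal allocation $\mathbf X$ there is an allocation $\mathbf X'$ with $a(\mathbf X')=a(\mathbf X)$ such that one of the following holds for $\mathbf X'$: (a) no good is split among the players; (b) exactly one good is split, among at most three players; (c) exactly two goods are split, each one between two players.
   Context: $N=\{1,2,3\}$ is the set of players and $M=\{1,\dots,m\}$ ($m\ge 1$) the set of divisible homogeneous goods. $a_{ij}$ is the value of good $j$ to player $i$, with $\sum_{j\in M}a_{ij}=1$ for each $i\in N$. An allocation is a matrix $\mathbf X=(x_{ij})_{i\in N,j\in M}$ with $x_{ij}\ge0$ and $\sum_{i\in N}x_{ij}=1$ for every $j\in M$. Put $a_i(\mathbf X)=\sum_{j\in M}a_{ij}x_{ij}$ and $a(\mathbf X)=(a_1(\mathbf X),a_2(\mathbf X),a_3(\mathbf X))$. An allocation $\mathbf X$ is Pareto optimal if there is no allocation $\mathbf X'$ with $a_i(\mathbf X')\ge a_i(\mathbf X)$ for all $i\in N$ and strict inequality for at least one $i$. Good $j$ is split in $\mathbf X$ among the players $i$ with $x_{ij}>0$ if there are at least two such players; otherwise it is not split. *)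

theory Defs
  imports Complex_Main
begin

text \<open>Valuations and allocations are functions of a player and a good; only their values on
  \<open>players\<close> and \<open>goods m\<close> are relevant.\<close>

definition players :: "nat set" where
  "players = {1, 2, 3}"

definition goods :: "nat \<Rightarrow> nat set" where
  "goods m = {1..m}"

definition normalized :: "nat \<Rightarrow> (nat \<Rightarrow> nat \<Rightarrow> real) \<Rightarrow> bool" where
  "normalized m a \<longleftrightarrow> (\<forall>i\<in>players. (\<Sum>j\<in>goods m. a i j) = 1)"

definition allocation :: "nat \<Rightarrow> (nat \<Rightarrow> nat \<Rightarrow> real) \<Rightarrow> bool" where
  "allocation m X \<longleftrightarrow>
     (\<forall>i\<in>players. \<forall>j\<in>goods m. X i j \<ge> 0) \<and>
     (\<forall>j\<in>goods m. (\<Sum>i\<in>players. X i j) = 1)"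

definition payoff :: "nat \<Rightarrow> (nat \<Rightarrow> nat \<Rightarrow> real) \<Rightarrow> (nat \<Rightarrow> nat \<Rightarrow> real) \<Rightarrow> nat \<Rightarrow> real" where
  "payoff m a X i = (\<Sum>j\<in>goods m. a i j * X i j)"

definition pareto_optimal ::
  "nat \<Rightarrow> (nat \<Rightarrow> nat \<Rightarrow> real) \<Rightarrow> (nat \<Rightarrow> nat \<Rightarrow> real) \<Rightarrow> bool" where
  "pareto_optimal m a X \<longleftrightarrow>
     allocation m X \<and>
     \<not> (\<exists>Y. allocation m Y \<and>
            (\<forall>i\<in>players. payoff m a Y i \<ge> payoff m a X i) \<and>
            (\<exists>i\<in>players. payoff m a Y i > payoff m a X i))"

definition holders :: "(nat \<Rightarrow> nat \<Rightarrow> real) \<Rightarrow> nat \<Rightarrow> nat set" where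
  "holders X j = {i \<in> players. X i j > 0}"

definition split_goods :: "nat \<Rightarrow> (nat \<Rightarrow> nat \<Rightarrow> real) \<Rightarrow> nat set" where
  "split_goods m X = {j \<in> goods m. card (holders X j) \<ge> 2}"

end

theory Submission
  imports Defs "HOL-Analysis.Analysis"
begin

text \<open>Among the allocations with the payoffs of \<open>X\<close>, take one with the smallest support. If
  its excess, the sum over the goods of (number of holders minus one), were at least 3, then the
  directions that preserve the unit sums and live on the support would form a space of dimension
  at least 3. A linear map from a 3-dimensional subspace of it to the payoff space of dimension 3
  either has a kernel, and moving along a kernel element until an entry vanishes shrinks the
  support, or it is onto, and some direction improves all players at once, against Pareto
  optimality. Hence the excess is at most 2, which leaves just the three listed patterns.\<close>

section \<open>Step lengths and linear maps in general\<close>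

text \<open>The longest admissible step is the least ratio \<open>x p / (- d p)\<close> over the
  decreasing entries; an entry attaining it drops to 0. If nothing decreases, any positive step will
  do.\<close>

lemma ratio_test:
  fixes x d :: "'a \<Rightarrow> real"
  assumes "finite S" and pos: "\<forall>p\<in>S. x p > 0"
  shows "\<exists>t>0. (\<forall>p\<in>S. x p + t * d p \<ge> 0) \<and>
    ((\<exists>p\<in>S. d p < 0) \<longrightarrow> (\<exists>p\<in>S. x p + t * d p = 0))"
proof (cases "\<exists>p\<in>S. d p < 0")
  case False
  then show ?thesis
    using pos by (intro exI[of _ 1]) (auto simp: not_less intro: add_nonneg_nonneg less_imp_le)
next
  case True
  define R where "R = (\<lambda>p. x p / (- d p)) ` {p \<in> S. d p < 0}"
  have R: "finite R" "R \<noteq> {}"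
    using assms(1) True by (auto simp: R_def)
  have "Min R \<in> R"
    using R by simp
  then obtain q where q: "q \<in> S" "d q < 0" "Min R = x q / (- d q)"
    by (auto simp: R_def)
  then have "Min R > 0"
    using pos by (simp add: divide_pos_neg)
  have "x p + Min R * d p \<ge> 0" if "p \<in> S" for p
  proof (cases "d p < 0")
    case True
    then have "Min R \<le> x p / (- d p)"
      using R that by (intro Min_le) (auto simp: R_def)
    with True show ?thesis
      by (simp add: field_simps)
  next
    case False
    with \<open>Min R > 0\<close> that pos show ?thesis
      by (simp add: not_less less_imp_le)
  qed
  moreover have "x q + Min R * d q = 0"
    using q by simp
  ultimately show ?thesis
    using \<open>Min R > 0\<close> q(1) by blast
qed

text \<open>An injective endomorphism in finite dimension is onto, which gives \<open>t = 1\<close>;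
  otherwise a kernel vector gives \<open>t = 0\<close>. One equation covers both cases, so they can
  be treated together later.\<close>

lemma linear_kernel_or_hits:
  fixes f :: "'a::euclidean_space \<Rightarrow> 'a"
  assumes "linear f" and "b \<noteq> 0"
  obtains c t where "c \<noteq> 0" "t \<ge> 0" "f c = t *\<^sub>R b"
proof (cases "inj f")
  case True
  then obtain c where "f c = b"
    using linear_injective_imp_surjective[OF assms(1)] by (metis surjD)
  moreover from this have "c \<noteq> 0"
    using assms linear_0 by blast
  ultimately show ?thesis
    by (intro that[of c 1]) auto
next
  case False
  then obtain c where "f c = 0" "c \<noteq> 0"
    using linear_injective_0[OF assms(1)] by blast
  then show ?thesis
    by (intro that[of c 0]) auto
qed

section \<open>Holders, payoffs and supports\<close>

lemma finite_players [simp]: "finite players" and card_players: "card players = 3"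
  by (simp_all add: players_def)

lemma finite_goods [simp]: "finite (goods m)"
  by (simp add: goods_def)

lemma finite_holders [simp]: "finite (holders X j)"
  by (simp add: holders_def)

lemma holders_nonempty:
  assumes "allocation m X" "j \<in> goods m"
  shows "holders X j \<noteq> {}"
proof
  assume "holders X j = {}"
  then have "(\<Sum>i\<in>players. X i j) \<le> 0"
    by (intro sum_nonpos) (auto simp: holders_def not_less)
  with assms show False
    by (auto simp: allocation_def)
qed

lemma payoff_add_scale:
  "payoff m a (\<lambda>i j. X i j + t * d i j) i = payoff m a X i + t * payoff m a d i"
  by (simp add: payoff_def algebra_simps sum.distrib sum_distrib_left)

definition support :: "nat \<Rightarrow> (nat \<Rightarrow> nat \<Rightarrow> real) \<Rightarrow> (nat \<times> nat) set" where
  "support m X = {(i, j). i \<in> players \<and> j \<in> goods m \<and> X i j > 0}"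

lemma finite_support [simp]: "finite (support m X)"
  by (rule finite_subset[of _ "players \<times> goods m"]) (auto simp: support_def)

section \<open>Moving along directions on the support\<close>

text \<open>Transfers of a good between two of its holders keep the unit sums. The excess counts
  independent transfers, and three of them match the three payoffs, so some nonzero combination
  changes all payoffs by the same amount \<open>t\<close>.\<close>

lemma exists_direction:
  assumes X: "allocation m X" and excess: "(\<Sum>j\<in>goods m. card (holders X j) - 1) \<ge> 3"
  obtains d t where "\<And>j. (\<Sum>i\<in>players. d i j) = 0"
    "\<And>i j. d i j \<noteq> 0 \<Longrightarrow> (i, j) \<in> support m X"
    "\<exists>i j. d i j \<noteq> 0" "t \<ge> 0" "\<And>i. i \<in> players \<Longrightarrow> payoff m a d i = t"
proof -
  \<comment> \<open>A base holder of each good, the source in every transfer of it; the minimum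
    merely fixes a choice.\<close>
  define h where "h j = Min (holders X j)" for j
  have h: "h j \<in> holders X j" if "j \<in> goods m" for j
    using holders_nonempty[OF X that] by (simp add: h_def)
  \<comment> \<open>Each pair of a good and a non-base holder indexes one transfer. The good comes
    first here, whereas in \<open>support\<close> the player does.\<close>
  define P where "P = Sigma (goods m) (\<lambda>j. holders X j - {h j})"
  have "card P = (\<Sum>j\<in>goods m. card (holders X j) - 1)"
    unfolding P_def by (subst card_SigmaI) (auto simp: h intro!: sum.cong)
  then have "card (UNIV :: 3 set) \<le> card P" and "finite P"
    using excess by (auto simp: P_def)
  then obtain p :: "3 \<Rightarrow> nat \<times> nat" where p: "range p \<subseteq> P" "inj p"
    using card_le_inj[of "UNIV :: 3 set" P] by auto
  obtain g :: "3 \<Rightarrow> nat" where g: "bij_betw g UNIV players"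
    using finite_same_card_bij[of "UNIV :: 3 set" players] by (auto simp: card_players)
  \<comment> \<open>The \<open>k\<close>-th transfer: one unit of the good \<open>fst (p k)\<close>
    goes from its base holder to \<open>snd (p k)\<close>.\<close>
  define u :: "3 \<Rightarrow> nat \<Rightarrow> nat \<Rightarrow> real" where
    "u k i j = of_bool ((j, i) = p k) - of_bool (j = fst (p k) \<and> i = h j)" for k i j
  have pk: "fst (p k) \<in> goods m" "snd (p k) \<in> holders X (fst (p k))"
    "snd (p k) \<noteq> h (fst (p k))" for k
    using p(1) by (auto simp: P_def image_subset_iff mem_Sigma_iff split_beta dest!: spec[of _ k])
  have u_sum: "(\<Sum>i\<in>players. u k i j) = 0" for k j
  proof (cases "j = fst (p k)")
    case True
    have "snd (p k) \<in> players" "h j \<in> players"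
      using pk[of k] h[of j] True by (auto simp: holders_def)
    then show ?thesis
      using True by (simp add: u_def sum_subtractf prod_eq_iff of_bool_def)
  next
    case False
    then show ?thesis
      by (auto simp: u_def prod_eq_iff)
  qed
  have u_support: "(i, j) \<in> support m X" if "u k i j \<noteq> 0" for k i j
    using that pk[of k] h[of j]
    by (auto simp: u_def support_def holders_def prod_eq_iff of_bool_def split: if_splits)
  \<comment> \<open>Only one of the chosen transfers touches a given non-base entry, so coefficients
    can be read off there: the transfers are linearly independent.\<close>
  have u_p: "u k (snd (p l)) (fst (p l)) = of_bool (k = l)" for k l
    using p(2) pk[of l] by (auto simp: u_def inj_eq)
  define d :: "real ^ 3 \<Rightarrow> nat \<Rightarrow> nat \<Rightarrow> real" where
    "d c i j = (\<Sum>k\<in>UNIV. c $ k * u k i j)" for c i j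
  define L :: "real ^ 3 \<Rightarrow> real ^ 3" where "L c = (\<chi> k. payoff m a (d c) (g k))" for c
  have d_add: "d (c + c') i j = d c i j + d c' i j" for c c' i j
    by (simp add: d_def distrib_right sum.distrib)
  have d_scale: "d (r *\<^sub>R c) i j = r * d c i j" for r c i j
    by (simp add: d_def sum_distrib_left mult.assoc)
  have "linear L"
    by (rule linearI)
      (simp_all add: L_def payoff_def vec_eq_iff d_add d_scale distrib_left sum.distrib
        sum_distrib_left mult.left_commute)
  \<comment> \<open>Here \<open>1\<close> is the all-ones vector, so hitting a multiple of it means
    equal gains for all players.\<close>
  moreover have "(1 :: real ^ 3) \<noteq> 0"
    by (simp add: vec_eq_iff)
  ultimately obtain c t where c: "c \<noteq> 0" "t \<ge> 0" "L c = t *\<^sub>R 1"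
    by (rule linear_kernel_or_hits)
  show ?thesis
  proof (rule that[of "d c" t])
    show "(\<Sum>i\<in>players. d c i j) = 0" for j
    proof -
      have "(\<Sum>i\<in>players. d c i j) = (\<Sum>k\<in>UNIV. c $ k * (\<Sum>i\<in>players. u k i j))"
        unfolding d_def sum_distrib_left by (rule sum.swap)
      then show ?thesis
        by (simp add: u_sum)
    qed
    show "(i, j) \<in> support m X" if "d c i j \<noteq> 0" for i j
    proof (rule ccontr)
      assume "(i, j) \<notin> support m X"
      then have "u k i j = 0" for k
        using u_support by blast
      with that show False
        by (simp add: d_def)
    qed
    obtain l where "c $ l \<noteq> 0"
      using c(1) by (auto simp: vec_eq_iff)
    moreover have "d c (snd (p l)) (fst (p l)) = c $ l"
      by (simp add: d_def u_p)
    ultimately show "\<exists>i j. d c i j \<noteq> 0"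
      by metis
    show "t \<ge> 0"
      by fact
    show "payoff m a (d c) i = t" if "i \<in> players" for i
    proof -
      have "i \<in> range g"
        using g that by (simp add: bij_betw_def)
      then obtain k where "i = g k"
        by blast
      then show ?thesis
        using c(3) by (simp add: L_def vec_eq_iff)
    qed
  qed
qed

text \<open>Pareto optimality forces the common gain to be 0, so the move by the ratio test keeps
  all payoffs while one positive entry vanishes and none appears.\<close>

lemma pareto_smaller_support:
  assumes "pareto_optimal m a X" and excess: "(\<Sum>j\<in>goods m. card (holders X j) - 1) \<ge> 3"
  obtains Y where "allocation m Y" "\<And>i. i \<in> players \<Longrightarrow> payoff m a Y i = payoff m a X i"
    "card (support m Y) < card (support m X)"
proof -
  have X: "allocation m X"
    using assms(1) by (simp add: pareto_optimal_def)
  obtain d t where d: "\<And>j. (\<Sum>i\<in>players. d i j) = 0"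
    "\<And>i j. d i j \<noteq> 0 \<Longrightarrow> (i, j) \<in> support m X" "\<exists>i j. d i j \<noteq> 0"
    and t: "t \<ge> 0" "\<And>i. i \<in> players \<Longrightarrow> payoff m a d i = t"
    using exists_direction[OF X excess] by blast
  have "\<forall>q\<in>support m X. case_prod X q > 0"
    by (auto simp: support_def)
  from ratio_test[OF finite_support this, of "case_prod d"] obtain s where s: "s > 0"
    "\<forall>q\<in>support m X. case_prod X q + s * case_prod d q \<ge> 0"
    "(\<exists>q\<in>support m X. case_prod d q < 0) \<longrightarrow>
      (\<exists>q\<in>support m X. case_prod X q + s * case_prod d q = 0)"
    by blast
  define Y where "Y = (\<lambda>i j. X i j + s * d i j)"
  have outside: "Y i j = X i j" if "(i, j) \<notin> support m X" for i j
    using d(2) that by (auto simp: Y_def)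
  have "Y i j \<ge> 0" if "i \<in> players" "j \<in> goods m" for i j
    using that X bspec[OF s(2), of "(i, j)"] outside[of i j]
    by (cases "(i, j) \<in> support m X") (auto simp: allocation_def Y_def)
  moreover have "(\<Sum>i\<in>players. Y i j) = 1" if "j \<in> goods m" for j
    using X that d(1)[of j]
    by (simp add: allocation_def Y_def sum.distrib flip: sum_distrib_left)
  ultimately have Y: "allocation m Y"
    by (simp add: allocation_def)
  have payoff_Y: "payoff m a Y i = payoff m a X i + s * t" if "i \<in> players" for i
    using that t(2) by (simp add: Y_def payoff_add_scale)
  have "t = 0"
  proof (rule ccontr)
    assume "t \<noteq> 0"
    then have "payoff m a Y i > payoff m a X i" if "i \<in> players" for i
      using that payoff_Y s(1) t(1) by simp
    moreover have "1 \<in> players"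
      by (simp add: players_def)
    ultimately show False
      using assms(1) Y unfolding pareto_optimal_def by (meson less_imp_le)
  qed
  obtain k j where kj: "d k j \<noteq> 0"
    using d(3) by blast
  then have "k \<in> players"
    using d(2) by (auto simp: support_def)
  \<comment> \<open>The nonzero column of \<open>d\<close> sums to 0, so some entry in it decreases;
    the ratio test then really reaches a zero.\<close>
  have "\<exists>i\<in>players. d i j < 0"
  proof (rule ccontr)
    assume "\<not> ?thesis"
    then show False
      using d(1)[of j] kj \<open>k \<in> players\<close> by (auto simp: sum_nonneg_eq_0_iff not_less)
  qed
  then obtain i where "d i j < 0"
    by blast
  then have "(i, j) \<in> support m X"
    by (intro d(2)) simp
  with \<open>d i j < 0\<close> have "\<exists>q\<in>support m X. case_prod d q < 0"
    by (intro bexI[of _ "(i, j)"]) auto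
  with s(3) obtain i' j' where "(i', j') \<in> support m X" "Y i' j' = 0"
    by (auto simp: Y_def)
  moreover from this(2) have "(i', j') \<notin> support m Y"
    by (simp add: support_def)
  moreover have "support m Y \<subseteq> support m X"
    using outside by (fastforce simp: support_def)
  ultimately have "support m Y \<subset> support m X"
    by blast
  then have "card (support m Y) < card (support m X)"
    by (simp add: psubset_card_mono)
  with Y payoff_Y \<open>t = 0\<close> show ?thesis
    by (intro that[of Y]) auto
qed

section \<open>From the excess bound to the three patterns\<close>

text \<open>Each split good uses up one unit of excess, plus one more for every holder beyond the
  second. A budget of 2 allows at most two split goods, and two of them exhaust it.\<close>

lemma split_patterns:
  assumes "(\<Sum>j\<in>goods m. card (holders X j) - 1) \<le> 2"
  shows "split_goods m X = {} \<or>
       (card (split_goods m X) = 1 \<and> (\<forall>j\<in>split_goods m X. card (holders X j) \<le> 3)) \<or>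
       (card (split_goods m X) = 2 \<and> (\<forall>j\<in>split_goods m X. card (holders X j) = 2))"
proof -
  define S where "S = split_goods m X"
  have S: "finite S" "S \<subseteq> goods m" "\<And>j. j \<in> S \<Longrightarrow> card (holders X j) \<ge> 2"
    by (auto simp: S_def split_goods_def)
  have "(\<Sum>j\<in>S. card (holders X j) - 1) \<le> 2"
    using assms sum_mono2[OF finite_goods S(2), of "\<lambda>j. card (holders X j) - 1"] by simp
  moreover have "(\<Sum>j\<in>S. card (holders X j) - 1) = card S + (\<Sum>j\<in>S. card (holders X j) - 2)"
  proof -
    \<comment> \<open>The subtraction of 2 is not truncated because split goods have at least two
      holders.\<close>
    have "(\<Sum>j\<in>S. card (holders X j) - 1) = (\<Sum>j\<in>S. 1 + (card (holders X j) - 2))"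
      using S(3) by (intro sum.cong) fastforce+
    then show ?thesis
      by (simp only: sum.distrib card_eq_sum)
  qed
  ultimately have *: "card S + (\<Sum>j\<in>S. card (holders X j) - 2) \<le> 2"
    by simp
  then have bound: "card (holders X j) - 2 \<le> 2 - card S" if "j \<in> S" for j
    using member_le_sum[OF that, of "\<lambda>j. card (holders X j) - 2"] S(1) by simp
  consider "S = {}" | "card S = 1" | "card S = 2"
    using * S(1) by (cases "card S = 0") force+
  then show ?thesis
  proof cases
    case 2
    then have "card (holders X j) \<le> 3" if "j \<in> S" for j
      using bound[OF that] by simp
    with 2 show ?thesis
      by (simp flip: S_def)
  next
    case 3
    then have "card (holders X j) = 2" if "j \<in> S" for j
      using bound[OF that] S(3)[OF that] by simp
    with 3 show ?thesis
      by (simp flip: S_def)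
  qed (simp flip: S_def)
qed

theorem theorem5:
  fixes m :: nat and a :: "nat \<Rightarrow> nat \<Rightarrow> real" and X :: "nat \<Rightarrow> nat \<Rightarrow> real"
  assumes "m \<ge> 1"
    and "normalized m a"
    and MAC: "\<forall>i\<in>players. \<forall>j\<in>goods m. a i j > 0"
    and "pareto_optimal m a X"
  shows "\<exists>X'. allocation m X' \<and>
      (\<forall>i\<in>players. payoff m a X' i = payoff m a X i) \<and>
      (split_goods m X' = {} \<or>
       (card (split_goods m X') = 1 \<and>
          (\<forall>j\<in>split_goods m X'. card (holders X' j) \<le> 3)) \<or>
       (card (split_goods m X') = 2 \<and>
          (\<forall>j\<in>split_goods m X'. card (holders X' j) = 2)))"
proof -
  define Q where
    "Q Y \<longleftrightarrow> allocation m Y \<and> (\<forall>i\<in>players. payoff m a Y i = payoff m a X i)" for Y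
  have "Q X"
    using assms(4) by (simp add: Q_def pareto_optimal_def)
  then obtain Y where Y: "Q Y" "\<And>Z. Q Z \<Longrightarrow> card (support m Y) \<le> card (support m Z)"
    using ex_has_least_nat[of Q X "\<lambda>Z. card (support m Z)"] by blast
  \<comment> \<open>Optimality depends on an allocation only through its payoffs, so it passes from
    \<open>X\<close> to \<open>Y\<close>.\<close>
  have "pareto_optimal m a Y"
    using assms(4) Y(1) by (simp add: Q_def pareto_optimal_def)
  have "(\<Sum>j\<in>goods m. card (holders Y j) - 1) \<le> 2"
  proof (rule ccontr)
    assume "\<not> ?thesis"
    then have "(\<Sum>j\<in>goods m. card (holders Y j) - 1) \<ge> 3"
      by simp
    then obtain Z where "allocation m Z" "\<And>i. i \<in> players \<Longrightarrow> payoff m a Z i = payoff m a Y i"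
      "card (support m Z) < card (support m Y)"
      using pareto_smaller_support[OF \<open>pareto_optimal m a Y\<close>] by blast
    then show False
      using Y by (fastforce simp: Q_def)
  qed
  from split_patterns[OF this] Y(1) show ?thesis
    unfolding Q_def by blast
qed

end
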